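(* For all real $d\times d$ matrices $A$ and $B$, \[ \mathbb{E}_{P,S}\det\!\big(xI-(A+PBS^T)(A+PBS^T)^T\big)=\mathbb{E}_{Q,R}\det\!\big(xI-(A+QBR^T)(A+QBR^T)^T\big), \] where $P,S$ are independent uniformly random $d\times d$ signed permutation matrices and $Q,R$ are independent Haar-random $d\times d$ real orthogonal matrices.
   Context: A signed permutation matrix is a matrix with entries in $\{0,\pm1\}$ having exactly one nonzero entry in each row and each column; a uniform random one is the product of a diagonal matrix with independent uniform $\pm1$ entries and a uniformly random permutation matrix. *)

theory Defs
  imports "HOL-Probability.Probability"
begin

definition signed_permutation_matrix :: "real ^ 'n ^ 'n \<Rightarrow> bool" where
  "signed_permutation_matrix P \<longleftrightarrow>
     (\<forall>i j. P $ i $ j \<in> {0, 1, -1}) \<and>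
     (\<forall>i. \<exists>!j. P $ i $ j \<noteq> 0) \<and>
     (\<forall>j. \<exists>!i. P $ i $ j \<noteq> 0)"

(* pmf_of_set is only specified on finite nonempty sets; the next two lemmas
   show that it is used properly below. *)

lemma finite_signed_permutation_matrices:
  "finite {P :: real ^ 'n ^ 'n. signed_permutation_matrix P}"
proof -
  let ?F = "UNIV \<rightarrow>\<^sub>E (UNIV \<rightarrow>\<^sub>E {0, 1, -1}) :: ('n \<Rightarrow> 'n \<Rightarrow> real) set"
  have "finite ?F"
    by (intro finite_PiE) auto
  moreover have "{P :: real ^ 'n ^ 'n. signed_permutation_matrix P} \<subseteq> (\<lambda>f. \<chi> i j. f i j) ` ?F"
  proof
    fix P :: "real ^ 'n ^ 'n"
    assume "P \<in> {P. signed_permutation_matrix P}"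
    then have "(\<lambda>i j. P $ i $ j) \<in> ?F"
      by (auto simp: signed_permutation_matrix_def PiE_def)
    moreover have "P = (\<chi> i j. P $ i $ j)"
      by simp
    ultimately show "P \<in> (\<lambda>f. \<chi> i j. f i j) ` ?F"
      using image_eqI[of P "\<lambda>f. \<chi> i j. f i j" "\<lambda>i j. P $ i $ j" ?F] by blast
  qed
  ultimately show ?thesis
    by (rule finite_surj)
qed

lemma signed_permutation_matrices_nonempty:
  "{P :: real ^ 'n ^ 'n. signed_permutation_matrix P} \<noteq> {}"
proof -
  have "signed_permutation_matrix (mat 1 :: real ^ 'n ^ 'n)"
    by (simp add: signed_permutation_matrix_def mat_def)
  then show ?thesis
    by blast
qed

definition uniform_signed_permutation :: "(real ^ 'n ^ 'n) pmf" where
  "uniform_signed_permutation = pmf_of_set {P. signed_permutation_matrix P}"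

(* Haar probability measure on O(d): a left-invariant Borel probability measure.
   As O(d) is compact there is exactly one such measure, and it is also right-invariant. *)
definition haar_orthogonal :: "(real ^ 'n ^ 'n) measure \<Rightarrow> bool" where
  "haar_orthogonal H \<longleftrightarrow>
     prob_space H \<and>
     sets H = sets (restrict_space borel {Q. orthogonal_matrix Q}) \<and>
     (\<forall>U. orthogonal_matrix U \<longrightarrow> distr H H (\<lambda>Q. U ** Q) = H)"

end

theory Submission imports Defs begin

text \<open>
  By a Cauchy-Binet expansion, \<open>det (x I - M M\<^sup>T)\<close> is a fixed linear combination of squares
  \<open>(det (Y + M K))\<^sup>2\<close>, so for the left factor it suffices to compare expectations of
  \<open>(det (A + Q B))\<^sup>2\<close>. Averaging this square over the signs \<open>D\<close> and permutations \<open>\<Pi>\<close>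
  in \<open>det (A + D \<Pi> B)\<close> removes all cross terms and leaves sums of squared determinants whose rows
  are rows of \<open>A\<close> or of \<open>\<Pi> B\<close>. Since a repeated row contributes zero, the sum over permutations can
  be replaced by a sum over all functions, and that sum depends on \<open>B\<close> only through
  \<open>B\<^sup>T B\<close>. Hence all probability measures on the orthogonal group that are left invariant under signed
  permutations give the same expectation. The right factor reduces to the left one by
  \<open>det (x I - M M\<^sup>T) = det (x I - M\<^sup>T M)\<close>.
\<close>

section \<open>Sums of weighted squared determinants over all choices of rows\<close>

lemma sum_prod_fun:
  fixes f :: "'n::finite \<Rightarrow> 'm::finite \<Rightarrow> 'a::comm_semiring_1"
  shows "(\<Sum>g\<in>UNIV. \<Prod>i\<in>UNIV. f i (g i)) = (\<Prod>i\<in>UNIV. \<Sum>k\<in>UNIV. f i k)"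
  using prod_sum_PiE[of UNIV "\<lambda>_. UNIV" f] by (simp add: PiE_UNIV_domain)

text \<open>After the Leibniz expansion of both determinants, each term is a product over rows
  \<open>i\<close> of a factor in \<open>g i\<close> alone, so the sum over \<open>g\<close> becomes
  a product of sums. Only the weighted second moments of each row's candidates survive.\<close>

lemma sum_weighted_det_square:
  fixes w :: "'n::finite \<Rightarrow> 'm::finite \<Rightarrow> 'a::comm_ring_1" and C :: "'n \<Rightarrow> 'm \<Rightarrow> 'n \<Rightarrow> 'a"
  shows "(\<Sum>g\<in>UNIV. (\<Prod>i\<in>UNIV. w i (g i)) * (det (\<chi> i j. C i (g i) j))\<^sup>2) =
    (\<Sum>p | p permutes UNIV. \<Sum>q | q permutes UNIV. of_int (sign p) * of_int (sign q) *
      (\<Prod>i\<in>UNIV. \<Sum>k\<in>UNIV. w i k * C i k (p i) * C i k (q i)))"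
proof -
  have "(\<Prod>i\<in>UNIV. w i (g i)) * (det (\<chi> i j. C i (g i) j))\<^sup>2 =
    (\<Sum>p | p permutes UNIV. \<Sum>q | q permutes UNIV. of_int (sign p) * of_int (sign q) *
      (\<Prod>i\<in>UNIV. w i (g i) * C i (g i) (p i) * C i (g i) (q i)))" for g
    by (simp add: det_def power2_eq_square sum_product sum_distrib_left prod.distrib ac_simps)
  then have "(\<Sum>g\<in>UNIV. (\<Prod>i\<in>UNIV. w i (g i)) * (det (\<chi> i j. C i (g i) j))\<^sup>2) =
    (\<Sum>g\<in>UNIV. \<Sum>p | p permutes UNIV. \<Sum>q | q permutes UNIV. of_int (sign p) * of_int (sign q) *
      (\<Prod>i\<in>UNIV. w i (g i) * C i (g i) (p i) * C i (g i) (q i)))"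
    by simp
  also have "\<dots> = (\<Sum>p | p permutes UNIV. \<Sum>q | q permutes UNIV. \<Sum>g\<in>UNIV. of_int (sign p) * of_int (sign q) *
      (\<Prod>i\<in>UNIV. w i (g i) * C i (g i) (p i) * C i (g i) (q i)))"
    by (subst sum.swap, intro sum.cong refl, subst sum.swap, rule refl)
  also have "\<dots> = (\<Sum>p | p permutes UNIV. \<Sum>q | q permutes UNIV. of_int (sign p) * of_int (sign q) *
      (\<Prod>i\<in>UNIV. \<Sum>k\<in>UNIV. w i k * C i k (p i) * C i k (q i)))"
    by (simp add: sum_distrib_left[symmetric] sum_prod_fun[of "\<lambda>i k. w i k * C i k (_ i) * C i k (_ i)"])
  finally show ?thesis .
qed

text \<open>Candidate rows may be exchanged for others with the same weighted second moments; this
  serves once for random signs and once for orthogonal mixing of rows.\<close>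

lemma sum_weighted_det_square_cong:
  fixes w :: "'n::finite \<Rightarrow> 'm::finite \<Rightarrow> 'a::comm_ring_1" and C :: "'n \<Rightarrow> 'm \<Rightarrow> 'n \<Rightarrow> 'a"
    and v :: "'n \<Rightarrow> 'l::finite \<Rightarrow> 'a" and D :: "'n \<Rightarrow> 'l \<Rightarrow> 'n \<Rightarrow> 'a"
  assumes "\<And>i a b. (\<Sum>k\<in>UNIV. w i k * C i k a * C i k b) = (\<Sum>k\<in>UNIV. v i k * D i k a * D i k b)"
  shows "(\<Sum>g\<in>UNIV. (\<Prod>i\<in>UNIV. w i (g i)) * (det (\<chi> i j. C i (g i) j))\<^sup>2) =
    (\<Sum>g\<in>UNIV. (\<Prod>i\<in>UNIV. v i (g i)) * (det (\<chi> i j. D i (g i) j))\<^sup>2)"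
  by (simp only: sum_weighted_det_square assms)

text \<open>A form of Cauchy-Binet. For fixed \<open>p\<close> the sum over \<open>q\<close> is
  \<open>sign p\<close> times the Gram determinant with rows permuted by \<open>p\<close>, so the
  two signs cancel; the factorial counts the choices of \<open>p\<close>.\<close>

lemma sum_weighted_det_square_gram:
  fixes w :: "'m::finite \<Rightarrow> 'a::comm_ring_1" and C :: "'m \<Rightarrow> 'n::finite \<Rightarrow> 'a"
  shows "(\<Sum>g\<in>UNIV. (\<Prod>i\<in>UNIV. w (g i)) * (det (\<chi> i j. C (g i) j))\<^sup>2) =
    of_nat (fact CARD('n)) * det (\<chi> a b. \<Sum>k\<in>UNIV. w k * C k a * C k b)"
proof -
  let ?G = "\<chi> a b. \<Sum>k\<in>UNIV. w k * C k a * C k b"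
  have "(\<Sum>q | q permutes UNIV. of_int (sign p) * of_int (sign q) *
      (\<Prod>i\<in>UNIV. \<Sum>k\<in>UNIV. w k * C k (p i) * C k (q i))) = det ?G"
    if p: "p permutes (UNIV :: 'n set)" for p
  proof -
    have "(\<Sum>q | q permutes UNIV. of_int (sign p) * of_int (sign q) *
      (\<Prod>i\<in>UNIV. \<Sum>k\<in>UNIV. w k * C k (p i) * C k (q i))) = of_int (sign p) * det (\<chi> i. ?G $ p i)"
      by (simp add: det_def sum_distrib_left mult.assoc)
    also have "\<dots> = of_int (sign p * sign p) * det ?G"
      by (simp only: det_permute_rows[OF p] of_int_mult mult.assoc)
    finally show ?thesis
      by (simp add: sign_idempotent)
  qed
  then show ?thesis
    unfolding sum_weighted_det_square[of "\<lambda>_. w" "\<lambda>_. C"]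
    by (simp add: card_permutations[OF refl])
qed

section \<open>Expansion of the characteristic polynomial of \<open>M ** transpose M\<close>\<close>

text \<open>
  A function \<^term>\<open>f :: 'n \<Rightarrow> 'n + 'n\<close> selects columns of the block matrix \<open>[I, M]\<close>; the
  selected matrix is \<open>pad_col f + M ** pick_col f\<close>.
\<close>

definition pad_col :: "('n::finite \<Rightarrow> 'n + 'n) \<Rightarrow> real ^ 'n ^ 'n" where
  "pad_col f = (\<chi> a i. case f i of Inl k \<Rightarrow> if a = k then 1 else 0 | Inr k \<Rightarrow> 0)"

definition pick_col :: "('n::finite \<Rightarrow> 'n + 'n) \<Rightarrow> real ^ 'n ^ 'n" where
  "pick_col f = (\<chi> a i. case f i of Inl k \<Rightarrow> 0 | Inr k \<Rightarrow> if a = k then 1 else 0)"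

text \<open>This is \<open>sum_weighted_det_square_gram\<close> for the columns of
  \<open>[I, M]\<close>, with weight \<open>x\<close> on those of \<open>I\<close> and -1 on those
  of \<open>M\<close>. The matrices on the right are affine in \<open>M\<close>, so expected
  characteristic polynomials reduce to expected squared determinants.\<close>

lemma det_diff_gram_eq_sum_squares:
  fixes M :: "real ^ 'n ^ 'n"
  shows "det (x *\<^sub>R mat 1 - M ** transpose M) =
    (\<Sum>f\<in>UNIV. (\<Prod>i\<in>UNIV. case f i of Inl k \<Rightarrow> x | Inr k \<Rightarrow> -1) / fact CARD('n) *
       (det (pad_col f + M ** pick_col f))\<^sup>2)"
proof -
  define w :: "'n + 'n \<Rightarrow> real" where "w = case_sum (\<lambda>_. x) (\<lambda>_. -1)"
  define C :: "'n + 'n \<Rightarrow> 'n \<Rightarrow> real" where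
    "C k a = (case k of Inl k \<Rightarrow> if a = k then 1 else 0 | Inr k \<Rightarrow> M $ a $ k)" for k a
  have "(\<chi> a b. \<Sum>k\<in>UNIV. w k * C k a * C k b) = x *\<^sub>R mat 1 - M ** transpose M"
    by (simp add: vec_eq_iff UNIV_Plus_UNIV[symmetric] sum.Plus w_def C_def matrix_matrix_mult_def transpose_def
        mat_def sum_negf if_distrib[of "\<lambda>u. x * u"] if_distrib[of "\<lambda>u. u * _"] del: UNIV_Plus_UNIV cong: if_cong)
  moreover have "(\<chi> i j. C (f i) j) = transpose (pad_col f + M ** pick_col f)" for f
    by (simp add: vec_eq_iff C_def transpose_def pad_col_def pick_col_def matrix_matrix_mult_def
        if_distrib[of "\<lambda>u. _ * u"] split: sum.split cong: if_cong)
  ultimately have "fact CARD('n) * det (x *\<^sub>R mat 1 - M ** transpose M) =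
      (\<Sum>f\<in>UNIV. (\<Prod>i\<in>UNIV. w (f i)) * (det (pad_col f + M ** pick_col f))\<^sup>2)"
    using sum_weighted_det_square_gram[of w C] by simp
  then show ?thesis
    by (simp add: w_def sum_divide_distrib[symmetric] field_simps)
qed

section \<open>Sums over permutations and signs\<close>

lemma inj_on_extend_to_permutation:
  fixes g :: "'a::finite \<Rightarrow> 'a"
  assumes "inj_on g U"
  obtains p where "p permutes UNIV" "\<And>i. i \<in> U \<Longrightarrow> p i = g i"
proof -
  have "card (- U) = card (- g ` U)"
    using assms by (simp add: Compl_eq_Diff_UNIV card_Diff_subset card_image)
  then obtain h where h: "bij_betw h (- U) (- g ` U)"
    using finite_same_card_bij[of "- U" "- g ` U"] by auto
  define p where "p i = (if i \<in> U then g i else h i)" for i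
  have "bij_betw p U (g ` U)"
    using assms by (subst bij_betw_cong[of _ _ g]) (auto simp: p_def bij_betw_def)
  moreover have "bij_betw p (- U) (- g ` U)"
    using h by (subst bij_betw_cong[of _ _ h]) (auto simp: p_def)
  ultimately have "bij_betw p (U \<union> - U) (g ` U \<union> - g ` U)"
    by (rule bij_betw_combine) auto
  then have "p permutes UNIV"
    by (auto intro: bij_imp_permutes simp: Compl_partition)
  then show thesis
    by (rule that) (simp add: p_def)
qed

text \<open>Double counting of the pairs of a permutation \<open>p\<close> and a function
  \<open>g\<close> that agree on \<open>U\<close>, weighted by \<open>F p = F g\<close>. A
  \<open>g\<close> injective on \<open>U\<close> extends to a permutation, and any other has weight
  zero.\<close>

lemma sum_permutations_eq_sum_functions:
  fixes F :: "('a::finite \<Rightarrow> 'a) \<Rightarrow> real" and U :: "'a set"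
  assumes F_cong: "\<And>g h. (\<And>i. i \<in> U \<Longrightarrow> g i = h i) \<Longrightarrow> F g = F h"
    and F_inj: "\<And>g. \<not> inj_on g U \<Longrightarrow> F g = 0"
  shows "real (card {g :: 'a \<Rightarrow> 'a. \<forall>i\<in>U. g i = i}) * (\<Sum>p | p permutes UNIV. F p) =
    real (card {p. p permutes UNIV \<and> (\<forall>i\<in>U. p i = i)}) * (\<Sum>g\<in>UNIV. F g)"
proof -
  \<comment> \<open>Composing with \<open>inv p\<close> turns agreement with \<open>p\<close> into
    fixing \<open>U\<close> pointwise. \<open>Q\<close> will be the trivial predicate first and
    being a permutation afterwards.\<close>
  have agree: "card {g. Q g \<and> (\<forall>i\<in>U. g i = p i)} = card {g. Q g \<and> (\<forall>i\<in>U. g i = i)}"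
    if p: "p permutes UNIV" and Q: "\<And>g r. Q g \<Longrightarrow> r permutes UNIV \<Longrightarrow> Q (r \<circ> g)"
    for p :: "'a \<Rightarrow> 'a" and Q
  proof (rule bij_betw_same_card[of "\<lambda>g. inv p \<circ> g"], rule bij_betwI[of _ _ _ "\<lambda>g. p \<circ> g"])
  qed (use Q p permutes_inv[OF p] in
      \<open>auto simp: fun_eq_iff permutes_inverses[OF p]\<close>)
  have "(\<Sum>p | p permutes UNIV. \<Sum>g\<in>UNIV. if \<forall>i\<in>U. g i = p i then F g else 0) =
    (\<Sum>p | p permutes UNIV. F p * real (card {g :: 'a \<Rightarrow> 'a. \<forall>i\<in>U. g i = i}))"
  proof (rule sum.cong[OF refl])
    fix p :: "'a \<Rightarrow> 'a"
    assume "p \<in> {p. p permutes UNIV}"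
    then have "card {g. \<forall>i\<in>U. g i = p i} = card {g :: 'a \<Rightarrow> 'a. \<forall>i\<in>U. g i = i}"
      using agree[of p "\<lambda>_. True"] by simp
    moreover have "(\<Sum>g\<in>UNIV. if \<forall>i\<in>U. g i = p i then F g else 0) =
        (\<Sum>g | \<forall>i\<in>U. g i = p i. F p)"
      by (simp only: sum.If_cases finite Int_UNIV_left sum.neutral_const add_0_right)
        (rule sum.cong[OF refl], rule F_cong, simp)
    ultimately show "(\<Sum>g\<in>UNIV. if \<forall>i\<in>U. g i = p i then F g else 0) =
        F p * real (card {g :: 'a \<Rightarrow> 'a. \<forall>i\<in>U. g i = i})"
      by simp
  qed
  moreover have "(\<Sum>g\<in>UNIV. \<Sum>p | p permutes UNIV. if \<forall>i\<in>U. g i = p i then F g else 0) =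
    (\<Sum>g\<in>UNIV. F g * real (card {p. p permutes UNIV \<and> (\<forall>i\<in>U. p i = i)}))"
  proof (rule sum.cong[OF refl])
    fix g :: "'a \<Rightarrow> 'a"
    show "(\<Sum>p | p permutes UNIV. if \<forall>i\<in>U. g i = p i then F g else 0) =
        F g * real (card {p. p permutes UNIV \<and> (\<forall>i\<in>U. p i = i)})"
    proof (cases "inj_on g U")
      case True
      then obtain r where r: "r permutes UNIV" "\<And>i. i \<in> U \<Longrightarrow> r i = g i"
        by (rule inj_on_extend_to_permutation) blast
      have "{p. p permutes UNIV} \<inter> {p. \<forall>i\<in>U. g i = p i} =
          {p. p permutes UNIV \<and> (\<forall>i\<in>U. p i = r i)}"
        using r(2) by auto
      then show ?thesis
        using agree[OF r(1), of "\<lambda>p. p permutes UNIV"]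
        by (simp add: sum.If_cases permutes_compose)
    next
      case False
      then have "F g = 0"
        by (rule F_inj)
      then show ?thesis
        by (simp cong: if_cong)
    qed
  qed
  ultimately show ?thesis
    by (subst (asm) sum.swap) (simp add: sum_distrib_right[symmetric] mult.commute)
qed

text \<open>In each row (a+b)(a'+b') + (a-b)(a'-b') = 2(aa' + bb'), so summing over the sign gives
  the same second moments as choosing the row of \<open>A\<close> or of \<open>B\<close> with weight
  2.\<close>

lemma sum_signs_det_square:
  fixes A B :: "real ^ 'n ^ 'n"
  shows "(\<Sum>s\<in>UNIV. (det (\<chi> i j. A $ i $ j + (if s i then 1 else -1) * B $ i $ j))\<^sup>2) =
    2 ^ CARD('n) * (\<Sum>s\<in>UNIV. (det (\<chi> i j. if s i then A $ i $ j else B $ i $ j))\<^sup>2)"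
  using sum_weighted_det_square_cong[of "\<lambda>(_::'n) (_::bool). 1 :: real"
      "\<lambda>i s j. A $ i $ j + (if s then 1 else -1) * B $ i $ j"
      "\<lambda>_ _. 2" "\<lambda>i s j. if s then A $ i $ j else B $ i $ j"]
  by (simp add: UNIV_bool algebra_simps sum_distrib_left)

text \<open>A diagonal sign matrix times a permutation matrix, encoded by its two parts so that
  signs and permutations can be summed separately.\<close>

definition sign_perm_matrix :: "('n \<Rightarrow> bool) \<Rightarrow> ('n \<Rightarrow> 'n) \<Rightarrow> real ^ 'n ^ 'n" where
  "sign_perm_matrix s p = (\<chi> i j. if j = p i then (if s i then 1 else -1) else 0)"

lemma sign_perm_matrix_mult_nth:
  "(sign_perm_matrix s p ** B) $ i $ j = (if s i then 1 else -1) * B $ p i $ j"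
  by (simp add: sign_perm_matrix_def matrix_matrix_mult_def if_distrib[of "\<lambda>u. u * _"] cong: if_cong)

lemma signed_permutation_sign_perm_matrix:
  assumes "p permutes UNIV"
  shows "signed_permutation_matrix (sign_perm_matrix s p)"
proof -
  have "\<exists>!i. j = p i" for j
    using permutes_univ[of p] assms by metis
  then show ?thesis
    by (auto simp: signed_permutation_matrix_def sign_perm_matrix_def)
qed

text \<open>A repeated row makes the determinant vanish, so both sides are the same multiple of sums
  over all functions. Those sums see \<open>B\<close> only through \<open>transpose B ** B\<close>,
  which an orthogonal \<open>Q\<close> preserves.\<close>

lemma sum_mixed_rows_det_square:
  fixes A B Q :: "real ^ 'n ^ 'n"
  assumes "orthogonal_matrix Q"
  shows "(\<Sum>p | p permutes UNIV. (det (\<chi> i j. if s i then A $ i $ j else (Q ** B) $ p i $ j))\<^sup>2) =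
    (\<Sum>p | p permutes UNIV. (det (\<chi> i j. if s i then A $ i $ j else B $ p i $ j))\<^sup>2)"
proof -
  define F where "F B g = (det (\<chi> i j. if s i then A $ i $ j else B $ g i $ j))\<^sup>2"
    for B :: "real ^ 'n ^ 'n" and g :: "'n \<Rightarrow> 'n"
  let ?U = "{i. \<not> s i}"
  let ?c = "real (card {g :: 'n \<Rightarrow> 'n. \<forall>i\<in>?U. g i = i})"
  have F_cong: "F B g = F B h" if "\<And>i. i \<in> ?U \<Longrightarrow> g i = h i" for B g h
    unfolding F_def by (intro arg_cong[of _ _ det] arg_cong2[of _ _ _ _ power] refl)
      (use that in \<open>auto simp: vec_eq_iff\<close>)
  have F_inj: "F B g = 0" if "\<not> inj_on g ?U" for B g
  proof -
    from that obtain i j where ij: "\<not> s i" "\<not> s j" "i \<noteq> j" "g i = g j"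
      by (auto simp: inj_on_def)
    then show ?thesis
      unfolding F_def by (subst det_identical_rows[of i j]) (auto simp: row_def vec_eq_iff)
  qed
  have "(\<Sum>k\<in>UNIV. (Q ** B) $ k $ a * (Q ** B) $ k $ b) = (\<Sum>k\<in>UNIV. B $ k $ a * B $ k $ b)" for a b
  proof -
    have "transpose (Q ** B) ** (Q ** B) = transpose B ** (transpose Q ** Q) ** B"
      by (simp add: matrix_transpose_mul matrix_mul_assoc)
    also have "\<dots> = transpose B ** B"
      using assms by (simp add: orthogonal_matrix)
    finally have "(transpose (Q ** B) ** (Q ** B)) $ a $ b = (transpose B ** B) $ a $ b"
      by simp
    then show ?thesis
      unfolding matrix_matrix_mult_def[of "transpose _"] by (simp add: transpose_def)
  qed
  \<comment> \<open>Rows with \<open>s i\<close> come from \<open>A\<close> whatever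
    \<open>k\<close> is; the others contribute an entry of the Gram matrix.\<close>
  then have "(\<Sum>k\<in>UNIV. 1 * (if s i then A $ i $ a else (Q ** B) $ k $ a) *
      (if s i then A $ i $ b else (Q ** B) $ k $ b)) =
    (\<Sum>k\<in>UNIV. 1 * (if s i then A $ i $ a else B $ k $ a) *
      (if s i then A $ i $ b else B $ k $ b))" for i a b
    by (cases "s i") simp_all
  then have "(\<Sum>g\<in>UNIV. F (Q ** B) g) = (\<Sum>g\<in>UNIV. F B g)"
    using sum_weighted_det_square_cong[of "\<lambda>(_::'n) (_::'n). 1 :: real"
      "\<lambda>i k j. if s i then A $ i $ j else (Q ** B) $ k $ j"
      "\<lambda>_ _. 1" "\<lambda>i k j. if s i then A $ i $ j else B $ k $ j"]
    by (simp add: F_def)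
  moreover have "?c * (\<Sum>p | p permutes UNIV. F B p) =
      real (card {p. p permutes UNIV \<and> (\<forall>i\<in>?U. p i = i)}) * (\<Sum>g\<in>UNIV. F B g)" for B
    using F_cong F_inj by (rule sum_permutations_eq_sum_functions)
  ultimately have "?c * (\<Sum>p | p permutes UNIV. F (Q ** B) p) = ?c * (\<Sum>p | p permutes UNIV. F B p)"
    by simp
  \<comment> \<open>The identity is among the functions counted.\<close>
  moreover have "?c \<noteq> 0"
    by (auto intro: exI[of _ id])
  ultimately have "(\<Sum>p | p permutes UNIV. F (Q ** B) p) = (\<Sum>p | p permutes UNIV. F B p)"
    by (rule mult_left_cancel[THEN iffD1, rotated])
  then show ?thesis
    by (simp only: F_def)
qed

text \<open>Summing over signs first removes the cross terms; for each remaining pattern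
  \<open>s\<close> of rows, the sum over permutations ignores \<open>Q\<close>.\<close>

lemma sum_sign_perm_det_square_orthogonal:
  fixes A B Q :: "real ^ 'n ^ 'n"
  assumes "orthogonal_matrix Q"
  shows "(\<Sum>p | p permutes UNIV. \<Sum>s\<in>UNIV. (det (A + sign_perm_matrix s p ** (Q ** B)))\<^sup>2) =
    (\<Sum>p | p permutes UNIV. \<Sum>s\<in>UNIV. (det (A + sign_perm_matrix s p ** B))\<^sup>2)"
proof -
  have "(\<Sum>s\<in>UNIV. (det (A + sign_perm_matrix s p ** B))\<^sup>2) =
     2 ^ CARD('n) * (\<Sum>s\<in>UNIV. (det (\<chi> i j. if s i then A $ i $ j else B $ p i $ j))\<^sup>2)"
    for B :: "real ^ 'n ^ 'n" and p
  proof -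
    have "A + sign_perm_matrix s p ** B = (\<chi> i j. A $ i $ j + (if s i then 1 else -1) * B $ p i $ j)" for s
      by (simp add: vec_eq_iff sign_perm_matrix_mult_nth)
    then show ?thesis
      using sum_signs_det_square[of A "\<chi> i. B $ p i"] by (simp cong: if_cong)
  qed
  then have "(\<Sum>p | p permutes UNIV. \<Sum>s\<in>UNIV. (det (A + sign_perm_matrix s p ** B))\<^sup>2) =
     2 ^ CARD('n) * (\<Sum>s\<in>UNIV. \<Sum>p | p permutes UNIV.
        (det (\<chi> i j. if s i then A $ i $ j else B $ p i $ j))\<^sup>2)"
    for B :: "real ^ 'n ^ 'n"
    by (subst (2) sum.swap) (simp add: sum_distrib_left)
  then show ?thesis
    by (simp add: sum_mixed_rows_det_square[OF assms])
qed

section \<open>Equality of the characteristic polynomials of \<open>M ** N\<close> and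
  \<open>N ** M\<close>\<close>

lemma poly_det: "poly (det P) t = det (\<chi> i j. poly (P $ i $ j) t)"
  by (simp add: det_def poly_sum poly_prod)

text \<open>Any \<open>t\<close> above the operator norm works: a kernel vector satisfies
  \<open>M *v v = - (t *\<^sub>R v)\<close>, which is too long unless \<open>v = 0\<close>.\<close>

lemma det_add_scalar_nonzero_exists:
  fixes M :: "real ^ 'n ^ 'n"
  shows "\<exists>t. det (M + mat t) \<noteq> 0"
proof
  let ?t = "onorm ((*v) M) + 1"
  have "0 \<le> onorm ((*v) M)"
    by (rule onorm_pos_le) (rule matrix_vector_mul_bounded_linear)
  have "v = 0" if "(M + mat ?t) *v v = 0" for v
  proof -
    have "mat ?t *v v = ?t *\<^sub>R v"
      by (simp add: vec_eq_iff mat_def matrix_vector_mult_def if_distrib[of "\<lambda>u. u * _"] cong: if_cong)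
    with that have "M *v v = - (?t *\<^sub>R v)"
      by (simp add: matrix_vector_mult_add_rdistrib eq_neg_iff_add_eq_0)
    then have "?t * norm v \<le> onorm ((*v) M) * norm v"
      using onorm[OF matrix_vector_mul_bounded_linear, of M v] \<open>0 \<le> onorm ((*v) M)\<close> by simp
    then show ?thesis
      by (simp add: distrib_right)
  qed
  then have "\<exists>N. N ** (M + mat ?t) = mat 1"
    unfolding matrix_left_invertible_ker by blast
  then show "det (M + mat ?t) \<noteq> 0"
    by (metis det_I det_mul mult_zero_right zero_neq_one)
qed

lemma mat_mult_commute:
  fixes M :: "'a::comm_ring_1 ^ 'n ^ 'n"
  shows "mat c ** M = M ** mat c"
  by (simp add: vec_eq_iff mat_def matrix_matrix_mult_def if_distrib[of "\<lambda>u. u * _"]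
      if_distrib[of "\<lambda>u. _ * u"] mult.commute cong: if_cong)

text \<open>After replacing \<^term>\<open>M\<close> by \<open>M + X I\<close> over the polynomial ring, its determinant
  can be cancelled.\<close>

lemma det_diff_mult_commute:
  fixes M N :: "real ^ 'n ^ 'n"
  shows "det (mat x - M ** N) = det (mat x - N ** M)"
proof -
  define M' :: "real poly ^ 'n ^ 'n" where "M' = (\<chi> i j. [:M $ i $ j, if i = j then 1 else 0:])"
  define N' :: "real poly ^ 'n ^ 'n" where "N' = (\<chi> i j. [:N $ i $ j:])"
  have "poly (det M') t = det (M + mat t)" for t
    by (auto simp: poly_det M'_def mat_def vec_eq_iff intro!: arg_cong[of _ _ det])
  then have "det M' \<noteq> 0"
    using det_add_scalar_nonzero_exists[of M] by (metis poly_0)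
  \<comment> \<open>Both sides expand to \<open>x M' - M' N' M'\<close>; taking determinants leaves
    a common factor \<open>det M'\<close>.\<close>
  have "(mat [:x:] - M' ** N') ** M' = M' ** (mat [:x:] - N' ** M')"
  proof -
    have "(mat [:x:] - M' ** N') ** M' = mat [:x:] ** M' - M' ** N' ** M'"
      by (simp add: vec_eq_iff matrix_matrix_mult_def[of _ M'] left_diff_distrib sum_subtractf)
    moreover have "M' ** (mat [:x:] - N' ** M') = M' ** mat [:x:] - M' ** (N' ** M')"
      by (simp add: vec_eq_iff matrix_matrix_mult_def[of M'] right_diff_distrib sum_subtractf)
    ultimately show ?thesis
      by (simp add: matrix_mul_assoc mat_mult_commute)
  qed
  then have "det (mat [:x:] - M' ** N') * det M' = det M' * det (mat [:x:] - N' ** M')"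
    by (metis det_mul)
  then have "det (mat [:x:] - M' ** N') = det (mat [:x:] - N' ** M')"
    using \<open>det M' \<noteq> 0\<close> by simp
  \<comment> \<open>Evaluating the indeterminate at 0 turns \<open>M'\<close> back into
    \<open>M\<close>.\<close>
  then have "poly (det (mat [:x:] - M' ** N')) 0 = poly (det (mat [:x:] - N' ** M')) 0"
    by simp
  then show ?thesis
    by (simp add: poly_det M'_def N'_def mat_def matrix_matrix_mult_def poly_sum minus_vec_def mult.commute
        if_distrib[of "\<lambda>p. poly p _"] cong: if_cong)
qed

lemma scaleR_mat_1: "x *\<^sub>R mat 1 = mat x"
  by (simp add: vec_eq_iff mat_def)

section \<open>Continuity of matrix operations and bounds on orthogonal matrices\<close>

lemma continuous_on_det [continuous_intros]:
  fixes f :: "'a::topological_space \<Rightarrow> real ^ 'n ^ 'n"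
  assumes "continuous_on S f"
  shows "continuous_on S (\<lambda>x. det (f x))"
  unfolding det_def by (intro continuous_intros assms)

lemma continuous_on_matrix_mult [continuous_intros]:
  fixes f :: "'a::topological_space \<Rightarrow> real ^ 'n ^ 'm" and g :: "'a \<Rightarrow> real ^ 'l ^ 'n"
  assumes "continuous_on S f" "continuous_on S g"
  shows "continuous_on S (\<lambda>x. f x ** g x)"
  unfolding matrix_matrix_mult_def by (intro continuous_intros assms)

lemma continuous_on_transpose [continuous_intros]:
  fixes f :: "'a::topological_space \<Rightarrow> real ^ 'n ^ 'm"
  assumes "continuous_on S f"
  shows "continuous_on S (\<lambda>x. transpose (f x))"
  unfolding transpose_def by (intro continuous_intros assms)

text \<open>The rows are unit vectors, and the Euclidean norm is at most the sum of the row norms.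
  The crude bound suffices for integrability.\<close>

lemma norm_orthogonal_matrix_le:
  fixes Q :: "real ^ 'n ^ 'n"
  assumes "orthogonal_matrix Q"
  shows "norm Q \<le> CARD('n)"
proof -
  have "norm (Q $ i) = 1" for i
    using assms by (simp add: orthogonal_matrix_orthonormal_rows row_def)
  then show ?thesis
    using L2_set_le_sum[of UNIV "\<lambda>i. norm (Q $ i)"] by (simp add: norm_vec_def)
qed

lemma orthogonal_matrix_signed_permutation:
  assumes "signed_permutation_matrix P"
  shows "orthogonal_matrix P"
proof -
  have "\<exists>j. P $ i $ j \<noteq> 0 \<and> (\<forall>k. k \<noteq> j \<longrightarrow> P $ i $ k = 0)" for i
    using assms unfolding signed_permutation_matrix_def by metis
  then obtain c where c: "\<And>i. P $ i $ c i \<noteq> 0" "\<And>i k. k \<noteq> c i \<Longrightarrow> P $ i $ k = 0"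
    by metis
  \<comment> \<open>\<open>c i\<close> is the column of the only nonzero entry in row
    \<open>i\<close>. For distinct rows the product vanishes, because column \<open>c i\<close> has
    a single nonzero entry too.\<close>
  have row: "(\<Sum>k\<in>UNIV. P $ i $ k * P $ j $ k) = P $ i $ c i * P $ j $ c i" for i j
    using c(2) by (subst sum.mono_neutral_right[of _ "{c i}"]) auto
  have "P $ i $ c i * P $ i $ c i = 1" for i
  proof -
    have "P $ i $ c i \<in> {0, 1, -1}"
      using assms by (simp only: signed_permutation_matrix_def)
    then show ?thesis
      using c(1)[of i] by auto
  qed
  moreover have "P $ j $ c i = 0" if "i \<noteq> j" for i j
    using assms c(1)[of i] that unfolding signed_permutation_matrix_def by metis
  ultimately have "P ** transpose P = mat 1"
    by (auto simp: vec_eq_iff matrix_matrix_mult_def transpose_def mat_def row)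
  then show ?thesis
    using orthogonal_matrix_transpose[of P] by (simp add: orthogonal_matrix)
qed

section \<open>Measures invariant under signed permutations\<close>

text \<open>The common ground of the uniform and the Haar measure. Their sigma-algebras and spaces
  differ, hence measurability of the identity and almost sure orthogonality in place of a fixed
  \<open>sets M\<close>.\<close>

definition sign_perm_invariant :: "(real ^ 'n ^ 'n) measure \<Rightarrow> bool" where
  "sign_perm_invariant M \<longleftrightarrow> prob_space M \<and> (\<lambda>Q. Q) \<in> borel_measurable M \<and>
     (AE Q in M. orthogonal_matrix Q) \<and>
     (\<forall>s p. p permutes UNIV \<longrightarrow> (\<lambda>Q. sign_perm_matrix s p ** Q) \<in> measurable M M \<and>
        distr M M (\<lambda>Q. sign_perm_matrix s p ** Q) = M)"

lemma set_pmf_uniform_signed_permutation: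
  "set_pmf uniform_signed_permutation = {P. signed_permutation_matrix P}"
  unfolding uniform_signed_permutation_def
  using signed_permutation_matrices_nonempty finite_signed_permutation_matrices
  by (rule set_pmf_of_set)

text \<open>Left multiplication by a signed permutation matrix is an injective self-map of a finite
  set, hence a bijection, and so preserves the uniform distribution.\<close>

lemma sign_perm_invariant_uniform_signed_permutation:
  "sign_perm_invariant (measure_pmf (uniform_signed_permutation :: (real ^ 'n ^ 'n) pmf))"
proof -
  let ?G = "{P :: real ^ 'n ^ 'n. signed_permutation_matrix P}"
  have *: "map_pmf (\<lambda>Q. sign_perm_matrix s p ** Q) (pmf_of_set ?G) = pmf_of_set ?G"
    if p: "p permutes UNIV" for s :: "'n \<Rightarrow> bool" and p
  proof (rule map_pmf_of_set_bij_betw)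
    let ?U = "sign_perm_matrix s p"
    have "orthogonal_matrix ?U"
      using p by (intro orthogonal_matrix_signed_permutation signed_permutation_sign_perm_matrix)
    then have inj: "inj_on (\<lambda>Q. ?U ** Q) ?G"
      by (intro inj_onI) (metis matrix_mul_assoc matrix_mul_lid orthogonal_matrix)
    have "(\<lambda>Q. ?U ** Q) ` ?G \<subseteq> ?G"
    proof clarify
      fix P :: "real ^ 'n ^ 'n"
      assume P: "signed_permutation_matrix P"
      have bij: "bij p"
        using p by (rule permutes_bij)
      \<comment> \<open>Row \<open>i\<close> of \<open>?U ** P\<close> is plus or minus row
        \<open>p i\<close> of \<open>P\<close>, so uniqueness within a column has to be carried
        along \<open>p\<close>.\<close>
      have "\<exists>!i. P $ p i $ j \<noteq> 0" for j
        using P bij unfolding signed_permutation_matrix_def by (metis bij_pointE)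
      then show "signed_permutation_matrix (?U ** P)"
        using P by (auto simp: signed_permutation_matrix_def sign_perm_matrix_mult_nth)
    qed
    then show "bij_betw (\<lambda>Q. ?U ** Q) ?G ?G"
      using inj finite_signed_permutation_matrices
      unfolding bij_betw_def by (intro conjI endo_inj_surj)
  qed (rule signed_permutation_matrices_nonempty finite_signed_permutation_matrices)+
  have "distr (measure_pmf uniform_signed_permutation) (measure_pmf uniform_signed_permutation)
      (\<lambda>Q. sign_perm_matrix s p ** Q) = measure_pmf uniform_signed_permutation"
    if "p permutes UNIV" for s :: "'n \<Rightarrow> bool" and p
  proof -
    have "distr (measure_pmf uniform_signed_permutation) (measure_pmf uniform_signed_permutation)
        (\<lambda>Q. sign_perm_matrix s p ** Q) =
      measure_pmf (map_pmf (\<lambda>Q. sign_perm_matrix s p ** Q) uniform_signed_permutation)"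
      unfolding map_pmf_rep_eq by (rule distr_cong) simp_all
    with that * show ?thesis
      by (simp add: uniform_signed_permutation_def)
  qed
  then show ?thesis
    using prob_space_measure_pmf orthogonal_matrix_signed_permutation
    by (auto simp: sign_perm_invariant_def AE_measure_pmf_iff set_pmf_uniform_signed_permutation)
qed

lemma space_haar_orthogonal:
  assumes "haar_orthogonal H"
  shows "space H = {Q. orthogonal_matrix Q}"
proof -
  have "sets H = sets (restrict_space borel {Q. orthogonal_matrix Q})"
    using assms by (simp add: haar_orthogonal_def)
  from sets_eq_imp_space_eq[OF this] show ?thesis
    by (simp add: space_restrict_space)
qed

text \<open>Signed permutation matrices are orthogonal, so invariance is a special case of Haar
  invariance; what remains is measurability in the restricted Borel space.\<close>

lemma sign_perm_invariant_haar:
  fixes H :: "(real ^ 'n ^ 'n) measure"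
  assumes "haar_orthogonal H"
  shows "sign_perm_invariant H"
proof -
  let ?O = "restrict_space borel {Q :: real ^ 'n ^ 'n. orthogonal_matrix Q}"
  have H: "prob_space H" "sets H = sets ?O"
    "\<And>U. orthogonal_matrix U \<Longrightarrow> distr H H (\<lambda>Q. U ** Q) = H"
    using assms by (auto simp: haar_orthogonal_def)
  have "(\<lambda>Q. U ** Q) \<in> measurable H H" if "orthogonal_matrix U" for U
  proof -
    have "(\<lambda>Q. U ** Q) \<in> measurable ?O ?O"
    proof (rule measurable_restrict_space2)
      show "(\<lambda>Q. U ** Q) \<in> measurable ?O borel"
        by (intro measurable_restrict_space1 borel_measurable_continuous_onI continuous_intros)
    qed (use that in \<open>auto simp: space_restrict_space orthogonal_matrix_mul\<close>)
    then show ?thesis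
      by (simp only: measurable_cong_sets[OF H(2) H(2)])
  qed
  moreover have "(\<lambda>Q. Q) \<in> borel_measurable H"
    unfolding measurable_cong_sets[OF H(2) refl] by (intro measurable_restrict_space1 measurable_ident_sets[OF refl])
  moreover have "AE Q in H. orthogonal_matrix Q"
    using space_haar_orthogonal[OF assms] by (auto intro: AE_I2)
  ultimately show ?thesis
    using H(1,3) orthogonal_matrix_signed_permutation[OF signed_permutation_sign_perm_matrix]
    by (auto simp: sign_perm_invariant_def)
qed

lemma continuous_on_ball_abs_bounded:
  fixes f :: "'a::euclidean_space \<Rightarrow> real"
  assumes "continuous_on UNIV f"
  obtains c where "\<And>x. norm x \<le> r \<Longrightarrow> \<bar>f x\<bar> \<le> c"
proof -
  have "compact (f ` cball 0 r)"
    using assms by (intro compact_continuous_image compact_cball) (rule continuous_on_subset, auto)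
  then have "bounded (f ` cball 0 r)"
    by (rule compact_imp_bounded)
  then obtain c where "\<forall>y\<in>f ` cball 0 r. \<bar>y\<bar> \<le> c"
    by (auto simp: bounded_iff)
  then show thesis
    by (intro that[of c]) auto
qed

text \<open>Almost every \<open>Q\<close> is orthogonal and so lies in a fixed ball, where a
  continuous function is bounded.\<close>

lemma sign_perm_invariant_integrable:
  fixes f :: "real ^ 'n ^ 'n \<Rightarrow> real"
  assumes M: "sign_perm_invariant M" and f: "continuous_on UNIV f"
  shows "integrable M f"
proof -
  interpret prob_space M
    using M by (simp add: sign_perm_invariant_def)
  obtain c where c: "\<And>Q. norm Q \<le> CARD('n) \<Longrightarrow> \<bar>f Q\<bar> \<le> c"
    using f by (rule continuous_on_ball_abs_bounded) blast
  show ?thesis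
  proof (rule integrable_const_bound[of _ c])
    have "AE Q in M. orthogonal_matrix Q"
      using M by (simp add: sign_perm_invariant_def)
    then show "AE Q in M. norm (f Q) \<le> c"
      by eventually_elim (simp add: c norm_orthogonal_matrix_le)
    have "(\<lambda>Q. Q) \<in> borel_measurable M"
      using M by (simp add: sign_perm_invariant_def)
    then show "f \<in> borel_measurable M"
      using f by (rule borel_measurable_continuous_on[rotated])
  qed
qed

section \<open>Independence of the expectations from the invariant measure\<close>

text \<open>By invariance \<open>Q\<close> may be replaced by
  \<open>sign_perm_matrix s p ** Q\<close> for every \<open>s\<close> and \<open>p\<close>. Summing
  these inside the integral gives an integrand that is constant on orthogonal \<open>Q\<close>, and
  the right-hand side does not mention \<open>M\<close>.\<close>

lemma sign_perm_invariant_expectation_det_square: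
  fixes A B :: "real ^ 'n ^ 'n"
  assumes M: "sign_perm_invariant M"
  shows "real (card {p. p permutes (UNIV :: 'n set)}) * real (card (UNIV :: ('n \<Rightarrow> bool) set)) *
      (\<integral>Q. (det (A + Q ** B))\<^sup>2 \<partial>M) =
    (\<Sum>p | p permutes UNIV. \<Sum>s\<in>UNIV. (det (A + sign_perm_matrix s p ** B))\<^sup>2)" (is "_ = ?S")
proof -
  interpret prob_space M
    using M by (simp add: sign_perm_invariant_def)
  have int: "integrable M (\<lambda>Q. (det (A + U ** (Q ** B)))\<^sup>2)" for U
    using M by (rule sign_perm_invariant_integrable) (intro continuous_intros)
  have "(\<integral>Q. (det (A + Q ** B))\<^sup>2 \<partial>M) = (\<integral>Q. (det (A + sign_perm_matrix s p ** (Q ** B)))\<^sup>2 \<partial>M)"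
    if "p permutes UNIV" for s p
  proof -
    have U: "(\<lambda>Q. sign_perm_matrix s p ** Q) \<in> measurable M M"
      "distr M M (\<lambda>Q. sign_perm_matrix s p ** Q) = M"
      using M that by (auto simp: sign_perm_invariant_def)
    have "integrable M (\<lambda>Q. (det (A + Q ** B))\<^sup>2)"
      using M by (rule sign_perm_invariant_integrable) (intro continuous_intros)
    then have "(\<lambda>Q. (det (A + Q ** B))\<^sup>2) \<in> borel_measurable M"
      by (rule borel_measurable_integrable)
    from integral_distr[OF U(1) this] show ?thesis
      by (simp add: U(2) matrix_mul_assoc)
  qed
  then have "real (card {p. p permutes (UNIV :: 'n set)}) * real (card (UNIV :: ('n \<Rightarrow> bool) set)) *
      (\<integral>Q. (det (A + Q ** B))\<^sup>2 \<partial>M) =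
    (\<Sum>p | p permutes UNIV. \<Sum>s\<in>UNIV. \<integral>Q. (det (A + sign_perm_matrix s p ** (Q ** B)))\<^sup>2 \<partial>M)"
    by simp
  also have "\<dots> = (\<integral>Q. (\<Sum>p | p permutes UNIV. \<Sum>s\<in>UNIV.
      (det (A + sign_perm_matrix s p ** (Q ** B)))\<^sup>2) \<partial>M)"
    by (simp add: Bochner_Integration.integral_sum Bochner_Integration.integrable_sum int)
  \<comment> \<open>Here \<open>Q\<close> disappears, by
    \<open>sum_sign_perm_det_square_orthogonal\<close>.\<close>
  also have "\<dots> = (\<integral>Q. ?S \<partial>M)"
  proof (rule integral_cong_AE)
    show "(\<lambda>Q. \<Sum>p | p permutes UNIV. \<Sum>s\<in>UNIV.
        (det (A + sign_perm_matrix s p ** (Q ** B)))\<^sup>2) \<in> borel_measurable M"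
      by (intro borel_measurable_sum borel_measurable_integrable int)
    have "AE Q in M. orthogonal_matrix Q"
      using M by (simp add: sign_perm_invariant_def)
    then show "AE Q in M. (\<Sum>p | p permutes UNIV. \<Sum>s\<in>UNIV.
        (det (A + sign_perm_matrix s p ** (Q ** B)))\<^sup>2) = ?S"
      by eventually_elim (rule sum_sign_perm_det_square_orthogonal)
  qed simp
  also have "\<dots> = ?S"
    by (simp add: prob_space)
  finally show ?thesis .
qed

text \<open>The expansion into squared determinants is linear with coefficients free of
  \<open>Q\<close>, so the comparison can be made term by term.\<close>

lemma sign_perm_invariant_expectation_unique:
  fixes A B :: "real ^ 'n ^ 'n"
  assumes M: "sign_perm_invariant M" and N: "sign_perm_invariant N"
  shows "(\<integral>Q. det (x *\<^sub>R mat 1 - (A + Q ** B) ** transpose (A + Q ** B)) \<partial>M) =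
    (\<integral>Q. det (x *\<^sub>R mat 1 - (A + Q ** B) ** transpose (A + Q ** B)) \<partial>N)"
proof -
  define w where "w f = (\<Prod>i\<in>UNIV. case f i of Inl (k::'n) \<Rightarrow> x | Inr (k::'n) \<Rightarrow> -1) / fact CARD('n)"
    for f :: "'n \<Rightarrow> 'n + 'n"
  have sq: "(\<integral>Q. (det (A + Q ** B))\<^sup>2 \<partial>M) = (\<integral>Q. (det (A + Q ** B))\<^sup>2 \<partial>N)"
    for A B :: "real ^ 'n ^ 'n"
  proof -
    have "real (card {p. p permutes (UNIV :: 'n set)}) * real (card (UNIV :: ('n \<Rightarrow> bool) set)) \<noteq> 0"
      by (simp add: card_permutations[OF refl])
    then show ?thesis
      by (rule mult_left_cancel[THEN iffD1])
        (simp only: sign_perm_invariant_expectation_det_square[OF M]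
          sign_perm_invariant_expectation_det_square[OF N])
  qed
  have expand: "(\<integral>Q. det (x *\<^sub>R mat 1 - (A + Q ** B) ** transpose (A + Q ** B)) \<partial>L) =
      (\<Sum>f\<in>UNIV. w f * (\<integral>Q. (det ((pad_col f + A ** pick_col f) + Q ** (B ** pick_col f)))\<^sup>2 \<partial>L))"
    if L: "sign_perm_invariant L" for L
  proof -
    have "integrable L (\<lambda>Q. (det (C + Q ** D))\<^sup>2)" for C D :: "real ^ 'n ^ 'n"
      using L by (rule sign_perm_invariant_integrable) (intro continuous_intros)
    \<comment> \<open>Selecting columns keeps the shape \<open>A + Q ** B\<close>, with new matrices
      in place of \<open>A\<close> and \<open>B\<close>.\<close>
    moreover have split: "pad_col f + (A + Q ** B) ** pick_col f =
        (pad_col f + A ** pick_col f) + Q ** (B ** pick_col f)" for Q f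
      unfolding matrix_mul_assoc
      by (simp add: vec_eq_iff matrix_matrix_mult_def[of _ "pick_col f"] distrib_right sum.distrib)
    ultimately show ?thesis
      unfolding det_diff_gram_eq_sum_squares w_def[symmetric] split by simp
  qed
  show ?thesis
    by (simp only: expand[OF M] expand[OF N] sq)
qed

lemma det_diff_gram_transpose:
  fixes M :: "real ^ 'n ^ 'n"
  shows "det (x *\<^sub>R mat 1 - transpose M ** M) = det (x *\<^sub>R mat 1 - M ** transpose M)"
  unfolding scaleR_mat_1 by (rule det_diff_mult_commute)

text \<open>Transposing \<open>A + B ** transpose R\<close> puts \<open>R\<close> on the left of
  \<open>transpose B\<close>, and the characteristic polynomial survives swapping the two Gram
  matrices.\<close>

lemma sign_perm_invariant_expectation_unique_right:
  fixes A B :: "real ^ 'n ^ 'n"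
  assumes "sign_perm_invariant M" and "sign_perm_invariant N"
  shows "(\<integral>R. det (x *\<^sub>R mat 1 - (A + B ** transpose R) ** transpose (A + B ** transpose R)) \<partial>M) =
    (\<integral>R. det (x *\<^sub>R mat 1 - (A + B ** transpose R) ** transpose (A + B ** transpose R)) \<partial>N)"
proof -
  have "transpose (A + B ** transpose R) = transpose A + R ** transpose B" for R
    by (simp add: vec_eq_iff transpose_def matrix_matrix_mult_def mult.commute)
  then have "det (x *\<^sub>R mat 1 - (A + B ** transpose R) ** transpose (A + B ** transpose R)) =
      det (x *\<^sub>R mat 1 - (transpose A + R ** transpose B) ** transpose (transpose A + R ** transpose B))" for R
    using det_diff_gram_transpose[of x "transpose A + R ** transpose B"] by (metis transpose_transpose)
  then show ?thesis
    by (simp only: sign_perm_invariant_expectation_unique[OF assms])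
qed

section \<open>Exchange of the two random factors, one after the other\<close>

lemma expectation_pair_pmf_finite:
  fixes f :: "'a \<times> 'b \<Rightarrow> real"
  assumes "finite (set_pmf p)" "finite (set_pmf q)"
  shows "measure_pmf.expectation (pair_pmf p q) f =
    measure_pmf.expectation q (\<lambda>b. measure_pmf.expectation p (\<lambda>a. f (a, b)))"
proof -
  have "measure_pmf.expectation (pair_pmf p q) f =
      (\<Sum>(a, b)\<in>set_pmf p \<times> set_pmf q. f (a, b) * (pmf p a * pmf q b))"
    using assms by (subst integral_measure_pmf_real[of "set_pmf p \<times> set_pmf q"])
      (auto simp: pmf_pair intro!: sum.cong)
  also have "\<dots> = (\<Sum>b\<in>set_pmf q. (\<Sum>a\<in>set_pmf p. f (a, b) * pmf p a) * pmf q b)"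
    unfolding sum.cartesian_product[symmetric]
    by (subst sum.swap) (simp add: sum_distrib_right mult.assoc)
  finally show ?thesis
    using assms by (simp add: integral_measure_pmf_real[of "set_pmf p"] integral_measure_pmf_real[of "set_pmf q"])
qed

theorem theorem2p3:
  fixes A B :: "real ^ 'n ^ 'n" and x :: real and H :: "(real ^ 'n ^ 'n) measure"
  assumes "haar_orthogonal H"
  shows "measure_pmf.expectation (pair_pmf uniform_signed_permutation uniform_signed_permutation)
           (\<lambda>(P, S). det (x *\<^sub>R mat 1 -
              (A + P ** B ** transpose S) ** transpose (A + P ** B ** transpose S))) =
         (\<integral>(Q, R). det (x *\<^sub>R mat 1 -
              (A + Q ** B ** transpose R) ** transpose (A + Q ** B ** transpose R)) \<partial>(H \<Otimes>\<^sub>M H))"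
proof -
  define g where "g Q R = det (x *\<^sub>R mat 1 -
    (A + Q ** B ** transpose R) ** transpose (A + Q ** B ** transpose R))" for Q R
  let ?p = "uniform_signed_permutation :: (real ^ 'n ^ 'n) pmf"
  note p_inv = sign_perm_invariant_uniform_signed_permutation
  have H_inv: "sign_perm_invariant H"
    using assms by (rule sign_perm_invariant_haar)
  have fin: "finite (set_pmf ?p)"
    by (simp add: set_pmf_uniform_signed_permutation finite_signed_permutation_matrices)
  interpret prob_space H
    using H_inv by (simp add: sign_perm_invariant_def)
  interpret pair_prob_space H H ..
  have cont: "continuous_on UNIV (\<lambda>z. g (fst z) (snd z))"
    unfolding g_def by (intro continuous_intros)
  have cont_left: "continuous_on UNIV (\<lambda>Q. g Q R)" for R
    unfolding g_def by (intro continuous_intros)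
  \<comment> \<open>With \<open>R\<close> fixed, \<open>B ** transpose R\<close> takes the role of
    \<open>B\<close>; in the next fact \<open>Q ** B\<close> does so with \<open>Q\<close>
    fixed.\<close>
  have left: "(\<integral>Q. g Q R \<partial>measure_pmf ?p) = (\<integral>Q. g Q R \<partial>H)" for R
    unfolding g_def matrix_mul_assoc[symmetric, of _ B]
    by (rule sign_perm_invariant_expectation_unique[OF p_inv H_inv])
  have right: "(\<integral>R. g Q R \<partial>measure_pmf ?p) = (\<integral>R. g Q R \<partial>H)" for Q
    unfolding g_def by (rule sign_perm_invariant_expectation_unique_right[OF p_inv H_inv])
  \<comment> \<open>Fubini for the Haar pair needs joint integrability: orthogonal pairs lie in a
    ball of radius twice the dimension, where the continuous integrand is bounded.\<close>
  have int: "integrable (H \<Otimes>\<^sub>M H) (\<lambda>(Q, R). g Q R)"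
  proof -
    let ?r = "real CARD('n) + real CARD('n)"
    obtain c where c: "\<And>z. norm z \<le> ?r \<Longrightarrow> \<bar>g (fst z) (snd z)\<bar> \<le> c"
      using cont by (rule continuous_on_ball_abs_bounded) blast
    have "\<bar>g Q R\<bar> \<le> c" if "orthogonal_matrix Q" "orthogonal_matrix R" for Q R
      using c[of "(Q, R)"] norm_Pair_le[of Q R] norm_orthogonal_matrix_le[OF that(1)]
        norm_orthogonal_matrix_le[OF that(2)] by simp
    then have "AE z in H \<Otimes>\<^sub>M H. norm (case z of (Q, R) \<Rightarrow> g Q R) \<le> c"
      by (intro AE_I2) (auto simp: space_pair_measure space_haar_orthogonal[OF assms])
    moreover have "(\<lambda>z. z) \<in> borel_measurable (H \<Otimes>\<^sub>M H)"
    proof -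
      have [measurable]: "(\<lambda>Q. Q) \<in> borel_measurable H"
        using H_inv by (simp add: sign_perm_invariant_def)
      have "(\<lambda>z. (fst z, snd z)) \<in> borel_measurable (H \<Otimes>\<^sub>M H)"
        by (intro borel_measurable_Pair measurable_compose[OF measurable_fst]
            measurable_compose[OF measurable_snd]) measurable
      then show ?thesis
        by simp
    qed
    then have "(\<lambda>z. g (fst z) (snd z)) \<in> borel_measurable (H \<Otimes>\<^sub>M H)"
      using cont by (rule borel_measurable_continuous_on[rotated])
    ultimately show ?thesis
      by (intro P.integrable_const_bound) (simp_all add: case_prod_unfold)
  qed
  have "measure_pmf.expectation (pair_pmf ?p ?p) (\<lambda>(P, S). g P S) =
      (\<integral>S. \<integral>P. g P S \<partial>measure_pmf ?p \<partial>measure_pmf ?p)"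
    using fin by (simp add: expectation_pair_pmf_finite)
  also have "\<dots> = (\<integral>S. \<integral>Q. g Q S \<partial>H \<partial>measure_pmf ?p)"
    by (simp only: left)
  \<comment> \<open>The uniform measure has finite support, so this only interchanges a finite sum
    with an integral.\<close>
  also have "\<dots> = (\<integral>Q. \<integral>S. g Q S \<partial>measure_pmf ?p \<partial>H)"
    using fin sign_perm_invariant_integrable[OF H_inv cont_left]
    by (simp add: integral_measure_pmf_real[of "set_pmf ?p"])
  also have "\<dots> = (\<integral>Q. \<integral>R. g Q R \<partial>H \<partial>H)"
    by (simp only: right)
  also have "\<dots> = (\<integral>(Q, R). g Q R \<partial>(H \<Otimes>\<^sub>M H))"
    using integral_fst'[OF int] by simp
  finally show ?thesis
    by (simp add: g_def)
qed

end
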